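(* Let $\{L_j: j\in J\}$ be any collection of nonempty, pairwise non-isomorphic linear orders. Then there exists a linear order $X$ such that $X\cong X^{\omega}(I_{[u]})$ for some family of linear orders $I_{[u]}$ indexed by the tail-equivalence classes $[u]$ of $X^\omega$ (and hence $X^2\cong X$), and moreover: (1) for $u,v\in X^\omega$ with $[u]\neq[v]$, either $I_{[u]}=I_{[v]}=\emptyset$ or $I_{[u]}$ and $I_{[v]}$ are non-isomorphic; (2) for every $j\in J$ there exists a unique tail-equivalence class $[u]$ with $I_{[u]}=L_j$.
   Context: $X^\omega$ is the set of infinite sequences of elements of $X$ ordered lexicographically. $u\sim v$ (tail-equivalence) iff there exist finite sequences $r,s$ of any lengths and $u'\in X^\omega$ with $u=ru'$ and $v=su'$ (concatenation); $[u]$ is the class of $u$. $X^\omega(I_{[u]})$ denotes the replacement in which each $u\in X^\omega$ is replaced by the order $I_{[u]}$ (possibly empty): the set $\{(u,i): u\in X^\omega, i\in I_{[u]}\}$ ordered lexicographically. *)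

theory Defs
  imports Main "HOL-Library.Stream"
begin

text \<open>
  A linear order is a reflexive relation \<open>r\<close> satisfying \<^term>\<open>Linear_order r\<close>; its underlying set
  is \<^term>\<open>Field r\<close>, so the empty order is \<^term>\<open>{}\<close>.
  An existential quantifier cannot range over types, so an order whose existence is asserted for a
  family \<open>L :: 'j \<Rightarrow> 'a rel\<close> is sought on \<open>(nat \<times> 'j \<times> 'a) list\<close>, a type with enough elements:
  it codes the finite trees whose nodes carry labels in \<open>'j \<times> 'a\<close>.
\<close>

text \<open>
  The library's \<^const>\<open>ordIso\<close> is confined to well-orders. The predicate \<^const>\<open>iso\<close> is not: for
  arbitrary relations it says that the function is a bijection of the fields that preserves and
  reflects the relation (\<open>iso_iff2\<close>).
\<close>

definition order_iso :: "'a rel \<Rightarrow> 'b rel \<Rightarrow> bool"  (infix "\<cong>\<^sub>o" 50)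
  where "r \<cong>\<^sub>o s \<longleftrightarrow> (\<exists>f. iso r s f)"

definition replacement :: "'a rel \<Rightarrow> ('a \<Rightarrow> 'b rel) \<Rightarrow> ('a \<times> 'b) rel"
  where "replacement r I =
    {((a, i), (b, k)). a \<in> Field r \<and> b \<in> Field r \<and> i \<in> Field (I a) \<and> k \<in> Field (I b) \<and>
       (a \<noteq> b \<and> (a, b) \<in> r \<or> a = b \<and> (i, k) \<in> I a)}"

text \<open>The lexicographic square is the replacement of every point of the order by the order itself.\<close>

definition order_square :: "'a rel \<Rightarrow> ('a \<times> 'a) rel"
  where "order_square r = replacement r (\<lambda>_. r)"

definition omega_power :: "'a rel \<Rightarrow> 'a stream rel"
  where "omega_power r =
    {(u, v). u \<in> streams (Field r) \<and> v \<in> streams (Field r) \<and>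
       (u = v \<or> (\<exists>n. (\<forall>m<n. u !! m = v !! m) \<and> u !! n \<noteq> v !! n \<and> (u !! n, v !! n) \<in> r))}"

definition tail_equiv :: "'a set \<Rightarrow> 'a stream rel"
  where "tail_equiv A =
    {(u, v). u \<in> streams A \<and> v \<in> streams A \<and>
       (\<exists>r \<in> lists A. \<exists>s \<in> lists A. \<exists>w \<in> streams A. u = r @- w \<and> v = s @- w)}"

definition tail_class :: "'a set \<Rightarrow> 'a stream \<Rightarrow> 'a stream set"
  where "tail_class A u = tail_equiv A `` {u}"

definition tail_classes :: "'a set \<Rightarrow> 'a stream set set"
  where "tail_classes A = streams A // tail_equiv A"

text \<open>\<open>omega_replacement X I\<close> is the order \<open>X\<^sup>\<omega>(I\<^bsub>[u]\<^esub>)\<close>; only the values of \<open>I\<close> on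
  \<^term>\<open>tail_classes (Field X)\<close> matter.\<close>

definition omega_replacement :: "'a rel \<Rightarrow> ('a stream set \<Rightarrow> 'b rel) \<Rightarrow> ('a stream \<times> 'b) rel"
  where "omega_replacement X I = replacement (omega_power X) (\<lambda>u. I (tail_class (Field X) u))"

lemma Field_omega_power: "Field (omega_power r) = streams (Field r)"
  unfolding omega_power_def Field_def by auto

lemma Linear_order_omega_power:
  assumes "Linear_order r"
  shows "Linear_order (omega_power r)"
proof -
  let ?R = "omega_power r"
  have tr: "trans r" and an: "antisym r" and tot: "total_on (Field r) r"
    using assms by (auto simp: order_on_defs)
  have nth: "u !! n \<in> Field r" if "u \<in> streams (Field r)" for u n
    using that by (metis snth_in)
  have refl: "refl_on (streams (Field r)) ?R" and sub: "?R \<subseteq> streams (Field r) \<times> streams (Field r)"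
    by (auto simp: refl_on_def omega_power_def)
  have trans: "trans ?R"
  proof (rule transI)
    fix u v w assume uv: "(u, v) \<in> ?R" and vw: "(v, w) \<in> ?R"
    show "(u, w) \<in> ?R"
    proof (cases "u = v \<or> v = w")
      case True with uv vw show ?thesis by auto
    next
      case False
      from uv False obtain n where n: "\<forall>m<n. u !! m = v !! m" "u !! n \<noteq> v !! n" "(u !! n, v !! n) \<in> r"
        by (auto simp: omega_power_def)
      from vw False obtain k where k: "\<forall>m<k. v !! m = w !! m" "v !! k \<noteq> w !! k" "(v !! k, w !! k) \<in> r"
        by (auto simp: omega_power_def)
      have S: "u \<in> streams (Field r)" "w \<in> streams (Field r)"
        using uv vw by (auto simp: omega_power_def)
      have "\<exists>l. (\<forall>m<l. u !! m = w !! m) \<and> u !! l \<noteq> w !! l \<and> (u !! l, w !! l) \<in> r"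
      proof (cases n k rule: linorder_cases)
        case less then show ?thesis using n k by (intro exI[of _ n]) auto
      next
        case greater then show ?thesis using n k by (intro exI[of _ k]) auto
      next
        case equal
        have "(u !! n, w !! n) \<in> r" using n k equal transD[OF tr] by metis
        moreover have "u !! n \<noteq> w !! n" using n k equal antisymD[OF an] by metis
        ultimately show ?thesis using n k equal by (intro exI[of _ n]) auto
      qed
      with S show ?thesis by (auto simp: omega_power_def)
    qed
  qed
  have antisym: "antisym ?R"
  proof (rule antisymI, rule ccontr)
    fix u v assume uv: "(u, v) \<in> ?R" and vu: "(v, u) \<in> ?R" and ne: "u \<noteq> v"
    from uv ne obtain n where n: "\<forall>m<n. u !! m = v !! m" "u !! n \<noteq> v !! n" "(u !! n, v !! n) \<in> r"
      by (auto simp: omega_power_def)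
    from vu ne obtain k where k: "\<forall>m<k. v !! m = u !! m" "v !! k \<noteq> u !! k" "(v !! k, u !! k) \<in> r"
      by (auto simp: omega_power_def)
    have "n = k" using n k by (metis linorder_neqE_nat)
    then show False using n k antisymD[OF an] by metis
  qed
  have total: "total_on (streams (Field r)) ?R"
  proof (rule total_onI)
    fix u v assume S: "u \<in> streams (Field r)" "v \<in> streams (Field r)" and ne: "u \<noteq> v"
    then have ex: "\<exists>n. u !! n \<noteq> v !! n"
      using smap_alt[of id u v] by (auto simp: stream.map_id)
    define n where "n = (LEAST n. u !! n \<noteq> v !! n)"
    have n: "u !! n \<noteq> v !! n" "\<forall>m<n. u !! m = v !! m"
      unfolding n_def using LeastI_ex[OF ex] not_less_Least by (auto)
    have "(u !! n, v !! n) \<in> r \<or> (v !! n, u !! n) \<in> r"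
      using tot n(1) nth S by (auto simp: total_on_def)
    then show "(u, v) \<in> ?R \<or> (v, u) \<in> ?R"
    proof
      assume "(u !! n, v !! n) \<in> r"
      with S n have "(u, v) \<in> ?R" by (auto simp: omega_power_def intro!: exI[of _ n])
      then show ?thesis ..
    next
      assume "(v !! n, u !! n) \<in> r"
      then have "(\<forall>m<n. v !! m = u !! m) \<and> v !! n \<noteq> u !! n \<and> (v !! n, u !! n) \<in> r"
        using n by metis
      with S have "(v, u) \<in> ?R" unfolding omega_power_def by blast
      then show ?thesis ..
    qed
  qed
  show ?thesis
    unfolding Field_omega_power using refl sub trans antisym total by (simp add: order_on_defs)
qed

lemma Field_replacement:
  assumes "Linear_order r" and "\<And>a. a \<in> Field r \<Longrightarrow> Linear_order (I a)"
  shows "Field (replacement r I) = (SIGMA a:Field r. Field (I a))"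
proof -
  have refl: "(i, i) \<in> I a" if "a \<in> Field r" "i \<in> Field (I a)" for a i
    using assms(2)[OF that(1)] that(2) by (auto simp: order_on_defs refl_on_def)
  have "replacement r I \<subseteq> (SIGMA a:Field r. Field (I a)) \<times> (SIGMA a:Field r. Field (I a))"
    by (auto simp: replacement_def)
  then have "Field (replacement r I) \<subseteq> (SIGMA a:Field r. Field (I a))"
    unfolding Field_def[of "replacement r I"] by blast
  moreover have "p \<in> Field (replacement r I)" if "p \<in> (SIGMA a:Field r. Field (I a))" for p
    using that refl by (intro FieldI1[of p p]) (auto simp: replacement_def)
  ultimately show ?thesis by blast
qed

lemma Linear_order_replacement:
  assumes "Linear_order r" and I: "\<And>a. a \<in> Field r \<Longrightarrow> Linear_order (I a)"
  shows "Linear_order (replacement r I)"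
proof -
  let ?F = "SIGMA a:Field r. Field (I a)" and ?R = "replacement r I"
  have r: "trans r" "antisym r" "total_on (Field r) r"
    using assms(1) by (auto simp: order_on_defs)
  have Ia: "trans (I a)" "antisym (I a)" "total_on (Field (I a)) (I a)" "refl_on (Field (I a)) (I a)"
    if "a \<in> Field r" for a
    using I[OF that] by (auto simp: order_on_defs)
  have "refl_on ?F ?R" "?R \<subseteq> ?F \<times> ?F"
    using Ia(4) by (auto simp: refl_on_def replacement_def)
  moreover have "trans ?R"
  proof (rule transI)
    fix p q t assume pq: "(p, q) \<in> ?R" and qt: "(q, t) \<in> ?R"
    obtain a i b k c l where [simp]: "p = (a, i)" "q = (b, k)" "t = (c, l)"
      by (metis surj_pair)
    have F: "a \<in> Field r" "i \<in> Field (I a)" "c \<in> Field r" "l \<in> Field (I c)"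
      and ab: "a \<noteq> b \<and> (a, b) \<in> r \<or> a = b \<and> (i, k) \<in> I a"
      and bc: "b \<noteq> c \<and> (b, c) \<in> r \<or> b = c \<and> (k, l) \<in> I b"
      using pq qt by (auto simp: replacement_def)
    have "a \<noteq> c \<and> (a, c) \<in> r \<or> a = c \<and> (i, l) \<in> I a"
    proof (cases "a = b \<or> b = c")
      case True
      then show ?thesis using ab bc transD[OF Ia(1)[OF F(1)]] by blast
    next
      case False
      then show ?thesis using ab bc transD[OF r(1)] antisymD[OF r(2)] by blast
    qed
    with F show "(p, t) \<in> ?R" by (simp add: replacement_def)
  qed
  moreover have "antisym ?R"
    using antisymD[OF r(2)] antisymD[OF Ia(2)]
    by (intro antisymI) (auto simp: replacement_def)
  moreover have "total_on ?F ?R"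
    using r(3) Ia(3) unfolding replacement_def total_on_def by fastforce
  ultimately show ?thesis
    using Field_replacement[of r I, OF assms(1) I] by (simp add: order_on_defs)
qed

lemma tail_equiv_iff_sdrop:
  "(u, v) \<in> tail_equiv A \<longleftrightarrow> u \<in> streams A \<and> v \<in> streams A \<and> (\<exists>m n. sdrop m u = sdrop n v)"
proof -
  have 1: "\<exists>m n. sdrop m u = sdrop n v" if "u = r @- w" "v = s @- w" for r s w
    using that by (intro exI[of _ "length r"] exI[of _ "length s"]) (simp add: sdrop_shift)
  have 2: "\<exists>r\<in>lists A. \<exists>s\<in>lists A. \<exists>w\<in>streams A. u = r @- w \<and> v = s @- w"
    if "u \<in> streams A" "v \<in> streams A" "sdrop m u = sdrop n v" for m n
  proof (intro bexI conjI)
    show "u = stake m u @- sdrop m u" by (simp add: stake_sdrop)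
    show "v = stake n v @- sdrop m u" by (simp add: that stake_sdrop)
    have "sset (stake m u @- sdrop m u) \<subseteq> A" "sset (stake n v @- sdrop n v) \<subseteq> A"
      unfolding stake_sdrop using that(1,2) by (auto simp: streams_iff_sset)
    then show "stake m u \<in> lists A" "stake n v \<in> lists A" "sdrop m u \<in> streams A"
      by (auto simp: streams_iff_sset lists_eq_set)
  qed
  show ?thesis unfolding tail_equiv_def using 1 2 by blast
qed

lemma equiv_tail_equiv: "equiv (streams A) (tail_equiv A)"
proof (rule equivI)
  show "tail_equiv A \<subseteq> streams A \<times> streams A" by (auto simp: tail_equiv_def)
  show "refl_on (streams A) (tail_equiv A)" by (auto simp: refl_on_def tail_equiv_iff_sdrop)
  show "sym (tail_equiv A)" by (auto simp: sym_def tail_equiv_iff_sdrop) metis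
  show "trans (tail_equiv A)"
  proof (rule transI)
    fix u v w assume "(u, v) \<in> tail_equiv A" "(v, w) \<in> tail_equiv A"
    then obtain m n k l where "sdrop m u = sdrop n v" "sdrop k v = sdrop l w"
      and S: "u \<in> streams A" "w \<in> streams A" by (auto simp: tail_equiv_iff_sdrop)
    then have "sdrop (m + k) u = sdrop (l + n) w"
      by (metis add.commute sdrop_add)
    with S show "(u, w) \<in> tail_equiv A" by (auto simp: tail_equiv_iff_sdrop)
  qed
qed

end

theory Submission
  imports Defs "HOL-Library.Nat_Bijection"
begin

text \<open>
  The classes carrying a nonempty order are those of constant streams \<open>x\<^sub>j x\<^sub>j x\<^sub>j \<dots>\<close>, one for each
  \<open>j\<close>. The points of \<open>X\<close> then have to be the triples \<open>(w, j, i)\<close> where \<open>i \<in> L\<^sub>j\<close> and \<open>w\<close> is a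
  finite word over \<open>X\<close> not ending in \<open>x\<^sub>j\<close>, standing for \<open>(w x\<^sub>j x\<^sub>j \<dots>, i)\<close>: finite trees with
  labelled nodes. The letter \<open>x\<^sub>j\<close> is the one-node tree \<open>([], j, i\<^sub>j)\<close> for some \<open>i\<^sub>j \<in> L\<^sub>j\<close>.
  The order that \<open>X\<close> must carry is determined by recursion on the size of the trees, except that
  comparing \<open>x\<^sub>j\<close> with \<open>x\<^sub>k\<close> leads back to itself; there any linear order on the indices may be
  used.
\<close>

section \<open>Order isomorphisms\<close>

lemma order_iso_refl: "r \<cong>\<^sub>o r"
  unfolding order_iso_def iso_iff2 by (intro exI[of _ id]) auto

lemma order_iso_sym:
  assumes "r \<cong>\<^sub>o s"
  shows "s \<cong>\<^sub>o r"
proof -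
  obtain f where f: "bij_betw f (Field r) (Field s)"
    "\<And>a b. a \<in> Field r \<Longrightarrow> b \<in> Field r \<Longrightarrow> (a, b) \<in> r \<longleftrightarrow> (f a, f b) \<in> s"
    using assms unfolding order_iso_def iso_iff2 by blast
  let ?g = "inv_into (Field r) f"
  have g: "bij_betw ?g (Field s) (Field r)"
    using f(1) by (rule bij_betw_inv_into)
  moreover have "(a, b) \<in> s \<longleftrightarrow> (?g a, ?g b) \<in> r" if "a \<in> Field s" "b \<in> Field s" for a b
    using that f(2)[of "?g a" "?g b"] bij_betwE[OF g] bij_betw_inv_into_right[OF f(1)] by simp
  ultimately show ?thesis
    unfolding order_iso_def iso_iff2 by blast
qed

lemma order_iso_trans:
  assumes "r \<cong>\<^sub>o s" and "s \<cong>\<^sub>o t"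
  shows "r \<cong>\<^sub>o t"
proof -
  obtain f where f: "bij_betw f (Field r) (Field s)"
    "\<And>a b. a \<in> Field r \<Longrightarrow> b \<in> Field r \<Longrightarrow> (a, b) \<in> r \<longleftrightarrow> (f a, f b) \<in> s"
    using assms(1) unfolding order_iso_def iso_iff2 by blast
  obtain g where g: "bij_betw g (Field s) (Field t)"
    "\<And>a b. a \<in> Field s \<Longrightarrow> b \<in> Field s \<Longrightarrow> (a, b) \<in> s \<longleftrightarrow> (g a, g b) \<in> t"
    using assms(2) unfolding order_iso_def iso_iff2 by blast
  show ?thesis
    unfolding order_iso_def iso_iff2
    using bij_betw_trans[OF f(1) g(1)] f(2) g(2) bij_betwE[OF f(1)]
    by (intro exI[of _ "g \<circ> f"]) auto
qed

lemma order_iso_emptyD: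
  assumes "{} \<cong>\<^sub>o r"
  shows "r = {}"
proof -
  have "Field r = {}"
    using assms unfolding order_iso_def iso_iff2 by (auto simp: bij_betw_def)
  then show ?thesis by (auto simp: Field_def)
qed

section \<open>Streams and tail classes\<close>

lemma stream_eq_iff_snth: "u = v \<longleftrightarrow> (\<forall>n. u !! n = v !! n)"
  using smap_alt[of id u v] by (auto simp: stream.map_id)

lemma stream_first_difference:
  assumes "u \<noteq> v"
  obtains n where "\<forall>m<n. u !! m = v !! m" "u !! n \<noteq> v !! n"
proof -
  have "\<exists>n. u !! n \<noteq> v !! n"
    using assms by (simp add: stream_eq_iff_snth)
  then show thesis
    using that exists_least_iff[of "\<lambda>n. u !! n \<noteq> v !! n"] by auto
qed

lemma tail_class_eq_iff:
  assumes "u \<in> streams A" and "v \<in> streams A"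
  shows "tail_class A u = tail_class A v \<longleftrightarrow> (\<exists>m n. sdrop m u = sdrop n v)"
  unfolding tail_class_def
  using assms by (simp add: eq_equiv_class_iff[OF equiv_tail_equiv] tail_equiv_iff_sdrop)

lemma tail_class_in_tail_classes: "u \<in> streams A \<Longrightarrow> tail_class A u \<in> tail_classes A"
  unfolding tail_class_def tail_classes_def by (rule quotientI)

lemma tail_class_Cons:
  assumes "x \<in> A" and "u \<in> streams A"
  shows "tail_class A (x ## u) = tail_class A u"
proof -
  have "sdrop 1 (x ## u) = sdrop 0 u" by simp
  then show ?thesis
    using assms by (subst tail_class_eq_iff) (simp_all only: streams_Stream, blast+)
qed

lemma shift_sconst_snth:
  "(w @- sconst a) !! n = (if n < length w then w ! n else a)"
  by (simp add: shift_snth)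

text \<open>Normal form of an eventually constant stream: the eventual value fixes the constant, and
  if one word were longer, its last letter would lie in the constant part of the other stream,
  against the hypotheses.\<close>

lemma shift_sconst_inject:
  assumes "w @- sconst a = v @- sconst b"
    and "w = [] \<or> last w \<noteq> a" and "v = [] \<or> last v \<noteq> b"
  shows "w = v \<and> a = b"
proof -
  have nth: "(if n < length w then w ! n else a) = (if n < length v then v ! n else b)" for n
    using arg_cong[OF assms(1), of "\<lambda>u. u !! n"] by (simp add: shift_sconst_snth)
  have ab: "a = b"
    using nth[of "length w + length v"] by simp
  have "length w = length v"
  proof (cases "length w" "length v" rule: linorder_cases)
    case less
    then have "last v = a"
      using nth[of "length v - 1"] by (cases "v = []") (auto simp: last_conv_nth split: if_splits)
    then show ?thesis using less assms(3) ab by auto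
  next
    case greater
    then have "last w = b"
      using nth[of "length w - 1"] by (cases "w = []") (auto simp: last_conv_nth split: if_splits)
    then show ?thesis using greater assms(2) ab by auto
  qed
  moreover have "w ! n = v ! n" if "n < length w" for n
    using nth[of n] that calculation by simp
  ultimately show ?thesis using ab by (simp add: list_eq_iff_nth_eq)
qed

section \<open>Splitting off the first letter, and the square\<close>

lemma omega_power_Cons:
  "(x ## u, y ## v) \<in> omega_power r \<longleftrightarrow>
    x \<in> Field r \<and> y \<in> Field r \<and> u \<in> streams (Field r) \<and> v \<in> streams (Field r) \<and>
    (x \<noteq> y \<and> (x, y) \<in> r \<or> x = y \<and> (u, v) \<in> omega_power r)"
proof -
  let ?d = "\<lambda>u v n. (\<forall>m<n. u !! m = v !! m) \<and> u !! n \<noteq> v !! n \<and> (u !! n, v !! n) \<in> r"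
  have "(\<exists>n. P n) \<longleftrightarrow> P 0 \<or> (\<exists>n. P (Suc n))" for P
    by (metis not0_implies_Suc)
  note this[of "?d (x ## u) (y ## v)"]
  moreover have "?d (x ## u) (y ## v) (Suc n) \<longleftrightarrow> x = y \<and> ?d u v n" for n
    by (auto simp: less_Suc_eq_0_disj)
  ultimately show ?thesis
    unfolding omega_power_def by (auto simp: streams_Stream)
qed

text \<open>Apply the given isomorphism to the second factor, then prepend the first coordinate to
  the resulting stream. Prepending leaves the tail class, hence the set of admissible labels,
  unchanged.\<close>

lemma order_square_iso_of_omega_replacement_iso:
  assumes X: "Linear_order X"
    and I: "\<And>c. c \<in> tail_classes (Field X) \<Longrightarrow> Linear_order (I c)"
    and iso: "X \<cong>\<^sub>o omega_replacement X I"
  shows "order_square X \<cong>\<^sub>o X"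
proof -
  let ?A = "Field X" and ?Y = "omega_replacement X I"
  obtain f where f: "bij_betw f ?A (Field ?Y)"
    "\<And>a b. a \<in> ?A \<Longrightarrow> b \<in> ?A \<Longrightarrow> (a, b) \<in> X \<longleftrightarrow> (f a, f b) \<in> ?Y"
    using iso unfolding order_iso_def iso_iff2 by blast
  have FY: "Field ?Y = (SIGMA u:streams ?A. Field (I (tail_class ?A u)))"
    unfolding omega_replacement_def
    using I tail_class_in_tail_classes
    by (subst Field_replacement) (use Linear_order_omega_power[OF X] in \<open>auto simp: Field_omega_power\<close>)
  have FS: "Field (order_square X) = ?A \<times> ?A"
    unfolding order_square_def using Field_replacement[of X "\<lambda>_. X"] X by simp
  define h where "h = (\<lambda>(x, y). (x ## fst (f y), snd (f y)))"
  have fA: "fst (f y) \<in> streams ?A" "snd (f y) \<in> Field (I (tail_class ?A (fst (f y))))"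
    if "y \<in> ?A" for y
    using bij_betwE[OF f(1)] that FY by (metis SigmaE fst_conv snd_conv)+
  have "bij_betw h (?A \<times> ?A) (Field ?Y)"
  proof (rule bij_betwI')
    fix p q assume "p \<in> ?A \<times> ?A" "q \<in> ?A \<times> ?A"
    then show "h p = h q \<longleftrightarrow> p = q"
      using bij_betw_imp_inj_on[OF f(1)]
      by (auto simp: h_def inj_on_def prod_eq_iff)
  next
    fix p assume "p \<in> ?A \<times> ?A"
    then show "h p \<in> Field ?Y"
      using fA by (auto simp: h_def FY streams_Stream tail_class_Cons)
  next
    fix q assume "q \<in> Field ?Y"
    then obtain u i where q: "q = (u, i)" "u \<in> streams ?A" "i \<in> Field (I (tail_class ?A u))"
      unfolding FY by blast
    obtain x v where u: "u = x ## v" by (cases u)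
    then have xv: "x \<in> ?A" "v \<in> streams ?A" using q(2) by (auto simp: streams_Stream)
    then have "(v, i) \<in> Field ?Y" using q(3) u by (simp add: FY tail_class_Cons)
    then obtain y where "y \<in> ?A" "f y = (v, i)"
      using f(1) by (metis bij_betw_iff_bijections)
    then show "\<exists>p \<in> ?A \<times> ?A. q = h p"
      using q(1) u xv(1) by (intro bexI[of _ "(x, y)"]) (auto simp: h_def)
  qed
  moreover have "(p, q) \<in> order_square X \<longleftrightarrow> (h p, h q) \<in> ?Y"
    if "p \<in> ?A \<times> ?A" "q \<in> ?A \<times> ?A" for p q
  proof -
    obtain x y x' y' where [simp]: "p = (x, y)" "q = (x', y')" by (metis surj_pair)
    have A: "x \<in> ?A" "y \<in> ?A" "x' \<in> ?A" "y' \<in> ?A" using that by auto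
    have "(y, y') \<in> X \<longleftrightarrow> (f y, f y') \<in> ?Y" using f(2) A by blast
    then show ?thesis
      using A fA[OF A(2)] fA[OF A(4)]
      unfolding h_def order_square_def omega_replacement_def replacement_def
      by (cases "f y"; cases "f y'")
        (auto simp: omega_power_Cons tail_class_Cons Field_omega_power streams_Stream)
  qed
  ultimately have "order_square X \<cong>\<^sub>o ?Y"
    unfolding order_iso_def iso_iff2 FS by blast
  then show ?thesis
    using order_iso_trans order_iso_sym[OF iso] by blast
qed

section \<open>Finite labelled trees coded as lists\<close>

text \<open>Storing the lengths of the subtree codes makes the coding injective on arbitrary lists.\<close>

definition node :: "(nat \<times> 'j \<times> 'a) list list \<Rightarrow> 'j \<Rightarrow> 'a \<Rightarrow> (nat \<times> 'j \<times> 'a) list"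
  where "node w j i = (list_encode (map length w), j, i) # concat w"

lemma node_inject: "node w j i = node w' j' i' \<longleftrightarrow> w = w' \<and> j = j' \<and> i = i'"
proof -
  have "w = w'" if "map length w = map length w'" "concat w = concat w'" for w w' :: "'c list list"
    using that
  proof (induction w arbitrary: w')
    case (Cons x w)
    then show ?case by (cases w') auto
  qed simp
  then show ?thesis
    unfolding node_def by (metis list.inject list_encode_eq prod.inject)
qed

text \<open>The entry for the root makes every child strictly shorter, so length serves as a size
  for induction on trees.\<close>

lemma length_less_length_node: "x \<in> set w \<Longrightarrow> length x < length (node w j i)"
  by (auto simp: node_def less_Suc_eq_le length_concat intro!: member_le_sum_list)

definition children :: "(nat \<times> 'j \<times> 'a) list \<Rightarrow> (nat \<times> 'j \<times> 'a) list list"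
  where "children x = (THE w. \<exists>j i. x = node w j i)"

definition root_index :: "(nat \<times> 'j \<times> 'a) list \<Rightarrow> 'j"
  where "root_index x = fst (snd (hd x))"

definition root_label :: "(nat \<times> 'j \<times> 'a) list \<Rightarrow> 'a"
  where "root_label x = snd (snd (hd x))"

lemma node_sel [simp]:
  "children (node w j i) = w" "root_index (node w j i) = j" "root_label (node w j i) = i"
  by (simp add: children_def node_inject, simp_all add: root_index_def root_label_def node_def)

section \<open>The self-similar order\<close>

text \<open>\<open>R\<close> is an arbitrary linear order on the indices; it decides comparisons of
  two leaves, where recursion gives no information.\<close>

locale order_family =
  fixes J :: "'j set" and L :: "'j \<Rightarrow> 'a rel" and R :: "'j rel"
  assumes L_linear: "j \<in> J \<Longrightarrow> Linear_order (L j)"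
    and L_nonempty: "j \<in> J \<Longrightarrow> L j \<noteq> {}"
    and L_not_iso: "i \<in> J \<Longrightarrow> j \<in> J \<Longrightarrow> i \<noteq> j \<Longrightarrow> \<not> L i \<cong>\<^sub>o L j"
    and R_linear: "linear_order_on J R"
begin

section \<open>Reduced trees and the streams they stand for\<close>

definition leaf :: "'j \<Rightarrow> (nat \<times> 'j \<times> 'a) list"
  where "leaf j = node [] j (SOME i. i \<in> Field (L j))"

text \<open>The condition on \<open>last w\<close> selects the shortest prefix among all ways to
  write one eventually constant stream, so that stream and label determine the tree.\<close>

inductive_set T :: "(nat \<times> 'j \<times> 'a) list set" where
  "\<lbrakk>\<forall>x \<in> set w. x \<in> T; j \<in> J; i \<in> Field (L j); w = [] \<or> last w \<noteq> leaf j\<rbrakk> \<Longrightarrow> node w j i \<in> T"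

definition word :: "(nat \<times> 'j \<times> 'a) list \<Rightarrow> (nat \<times> 'j \<times> 'a) list stream"
  where "word x = children x @- sconst (leaf (root_index x))"

text \<open>The rule \<open>step\<close> with \<open>n = 0\<close> derives a comparison of two leaves from itself only, which is why
  \<open>leaf\<close> is needed.\<close>

inductive less :: "(nat \<times> 'j \<times> 'a) list \<Rightarrow> (nat \<times> 'j \<times> 'a) list \<Rightarrow> bool" where
  leaf: "\<lbrakk>j \<in> J; k \<in> J; (j, k) \<in> R; j \<noteq> k\<rbrakk> \<Longrightarrow> less (leaf j) (leaf k)"
| label: "\<lbrakk>x \<in> T; y \<in> T; word x = word y; (root_label x, root_label y) \<in> L (root_index x);
    root_label x \<noteq> root_label y\<rbrakk> \<Longrightarrow> less x y"
| step: "\<lbrakk>x \<in> T; y \<in> T; \<forall>m<n. word x !! m = word y !! m; less (word x !! n) (word y !! n)\<rbrakk>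
    \<Longrightarrow> less x y"

definition X :: "(nat \<times> 'j \<times> 'a) list rel"
  where "X = {(x, y). x \<in> T \<and> y \<in> T \<and> (x = y \<or> less x y)}"

lemma T_D:
  assumes "x \<in> T"
  shows "x = node (children x) (root_index x) (root_label x)" "set (children x) \<subseteq> T"
    "root_index x \<in> J" "root_label x \<in> Field (L (root_index x))"
    "children x = [] \<or> last (children x) \<noteq> leaf (root_index x)"
  using assms by (auto elim: T.cases)

lemma leaf_sel [simp]: "children (leaf j) = []" "root_index (leaf j) = j"
  by (simp_all add: leaf_def)

lemma leaf_inject [simp]: "leaf j = leaf k \<longleftrightarrow> j = k"
  by (metis leaf_sel(2))

lemma word_leaf [simp]: "word (leaf j) = sconst (leaf j)"
  by (simp add: word_def)

text \<open>Nonemptiness of \<open>L j\<close> makes the choice of the label in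
  \<open>leaf j\<close> meaningful.\<close>

lemma leaf_in_T: "j \<in> J \<Longrightarrow> leaf j \<in> T"
proof -
  assume j: "j \<in> J"
  then have "\<exists>i. i \<in> Field (L j)" using L_nonempty by (fastforce simp: Field_def)
  then show ?thesis
    unfolding leaf_def using j by (intro T.intros) (auto intro: someI_ex)
qed

lemma word_in_streams: "x \<in> T \<Longrightarrow> word x \<in> streams T"
  using T_D(2)[of x] T_D(3)[of x] leaf_in_T
  by (auto simp: word_def streams_iff_sset)

lemma word_eq_iff:
  assumes "x \<in> T" "y \<in> T"
  shows "word x = word y \<longleftrightarrow> children x = children y \<and> root_index x = root_index y"
  using shift_sconst_inject[of "children x" "leaf (root_index x)" "children y" "leaf (root_index y)"]
    T_D(5)[OF assms(1)] T_D(5)[OF assms(2)]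
  by (auto simp: word_def)

lemma T_eqI:
  assumes "x \<in> T" "y \<in> T" "word x = word y" "root_label x = root_label y"
  shows "x = y"
  using assms T_D(1) word_eq_iff by metis

text \<open>Letters of the word are children of the tree or its trailing leaf; only the latter can
  fail to be smaller than the tree.\<close>

lemma word_snth_cases:
  assumes "x \<in> T"
  shows "length (word x !! n) < length x \<or> word x !! n = leaf (root_index x)"
  using T_D(1)[OF assms] length_less_length_node
  by (metis nth_mem shift_sconst_snth word_def)

section \<open>The relation \<open>less\<close> as a strict linear order\<close>

lemma less_in_T: "less x y \<Longrightarrow> x \<in> T \<and> y \<in> T"
  by (induction rule: less.induct) (auto intro: leaf_in_T)

lemma R_D: "trans R" "antisym R" "total_on J R"
  using R_linear by (auto simp: order_on_defs)

lemma L_D: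
  assumes "j \<in> J"
  shows "trans (L j)" "antisym (L j)" "total_on (Field (L j)) (L j)" "refl_on (Field (L j)) (L j)"
  using L_linear[OF assms] by (auto simp: order_on_defs)

text \<open>Derivations are finite: \<open>step\<close> passes from a tree compared with itself to a
  letter of its word compared with itself, and neither of the other rules can start such a
  chain.\<close>

lemma less_irrefl: "\<not> less x x"
proof -
  have "x \<noteq> y" if "less x y" for x y
    using that by (induction rule: less.induct) auto
  then show ?thesis by blast
qed

text \<open>Words of leaves are constant, so \<open>step\<close> only reproduces the same
  comparison, and \<open>label\<close> would force \<open>j = k\<close> and hence equal labels. A
  finite derivation must therefore start from rule \<open>leaf\<close>.\<close>

lemma less_leavesD: "less (leaf j) (leaf k) \<Longrightarrow> (j, k) \<in> R \<and> j \<noteq> k"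
proof (induction "leaf j" "leaf k" rule: less.induct)
  case label
  then have "j = k" using word_eq_iff leaf_sel(2) by metis
  then show ?case using label by simp
qed auto

text \<open>A comparison of leaves is also an instance of \<open>step\<close> at position 0, a leaf
  being the first letter of its own word. This leaves two cases for inversion.\<close>

lemma less_cases [consumes 1, case_names label step]:
  assumes "less x y"
  obtains "x \<in> T" "y \<in> T" "word x = word y" "(root_label x, root_label y) \<in> L (root_index x)"
      "root_label x \<noteq> root_label y"
    | n where "x \<in> T" "y \<in> T" "\<forall>m<n. word x !! m = word y !! m" "less (word x !! n) (word y !! n)"
  using assms
proof cases
  case (leaf j k)
  then have "less (word x !! 0) (word y !! 0)" using assms by simp
  then show thesis using that(2)[of 0] less_in_T[OF assms] by simp
qed (use that in blast)+

text \<open>At the smaller of two distinct positions, the agreement required by the other one would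
  contradict irreflexivity.\<close>

lemma less_step_first:
  assumes "\<forall>m<n. u !! m = v !! m" "less (u !! n) (v !! n)"
    and "\<forall>m<k. v !! m = u !! m" "less (v !! k) (u !! k)"
  shows "n = k"
  using assms less_irrefl by (metis linorder_neqE_nat)

text \<open>Induction on one comparison, inversion of the other. Two uses of \<open>step\<close>
  meet at the same position, where the induction hypothesis applies.\<close>

lemma less_asym: "less x y \<Longrightarrow> \<not> less y x"
proof (induction rule: less.induct)
  case (leaf j k)
  then show ?case using less_leavesD[of k j] antisymD[OF R_D(2)] by blast
next
  case (label x y)
  have "root_index x = root_index y" using label word_eq_iff by blast
  show ?case
  proof
    assume "less y x"
    then show False
    proof (cases rule: less_cases)
      case label': label
      then show False
        using label \<open>root_index x = root_index y\<close> antisymD[OF L_D(2)[OF T_D(3)[OF \<open>x \<in> T\<close>]]]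
        by metis
    next
      case (step n)
      then show False using label less_irrefl by metis
    qed
  qed
next
  case (step x y n)
  show ?case
  proof
    assume "less y x"
    then show False
    proof (cases rule: less_cases)
      case label
      then show False using step less_irrefl by metis
    next
      case step': (step k)
      then show False using step less_step_first by metis
    qed
  qed
qed

text \<open>The leaf case of transitivity, where induction on the first comparison offers no
  hypothesis; hence induction on the second. When \<open>z\<close> is not treated as a leaf,
  position 0 decides: the first letter of \<open>word z\<close> is \<open>leaf k\<close> or lies
  above it by a shorter derivation.\<close>

lemma less_leaf_trans:
  assumes "less (leaf k) z" "j \<in> J" "(j, k) \<in> R" "j \<noteq> k"
  shows "less (leaf j) z"
  using assms(1)
proof (induction "leaf k" z rule: less.induct)
  case (leaf k' l)
  then show ?case
    using assms transD[OF R_D(1)] antisymD[OF R_D(2)] less.leaf by (metis leaf_inject)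
next
  case (label z)
  then show ?case
    using less.leaf[of j k] less.step[of "leaf j" z 0] assms T_D(3)[of "leaf k"] leaf_in_T
    by (metis leaf_sel(2) not_less_zero siterate.simps(1) snth.simps(1) word_leaf)
next
  case (step z n)
  have k: "k \<in> J" using step(1) T_D(3)[of "leaf k"] by simp
  have "less (leaf j) (word z !! 0)"
  proof (cases n)
    case 0
    then show ?thesis using step by simp
  next
    case (Suc m)
    then have "word z !! 0 = leaf k" using step(3) by fastforce
    then show ?thesis using less.leaf[of j k] assms k by simp
  qed
  then show ?case using less.step[of "leaf j" z 0] step leaf_in_T assms(2) by simp
qed

text \<open>Induction on the first comparison, inversion of the second; two \<open>step\<close>
  positions merge into their minimum, and the induction hypothesis is needed when they
  coincide.\<close>

lemma less_trans: "less x y \<Longrightarrow> less y z \<Longrightarrow> less x z"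
proof (induction arbitrary: z rule: less.induct)
  case (leaf j k)
  then show ?case using less_leaf_trans by blast
next
  case (label x y)
  have ind: "root_index x = root_index y" using label word_eq_iff by blast
  from \<open>less y z\<close> show ?case
  proof (cases rule: less_cases)
    case label': label
    have "(root_label x, root_label z) \<in> L (root_index x)"
      using label label' ind transD[OF L_D(1)[OF T_D(3)[OF \<open>x \<in> T\<close>]]] by metis
    moreover have "root_label x \<noteq> root_label z"
      using label label' ind antisymD[OF L_D(2)[OF T_D(3)[OF \<open>x \<in> T\<close>]]] by metis
    ultimately show ?thesis using label label' less.label by metis
  next
    case (step n)
    then show ?thesis using label less.step by metis
  qed
next
  case (step x y n)
  from \<open>less y z\<close> show ?case
  proof (cases rule: less_cases)
    case label
    then show ?thesis using step less.step by metis
  next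
    case step': (step k)
    show ?thesis
    proof (cases n k rule: linorder_cases)
      case less
      then show ?thesis using step step' less.step[of x z n] by simp
    next
      case equal
      then show ?thesis using step step' less.step[of x z n] by simp
    next
      case greater
      then show ?thesis using step step' less.step[of x z k] by simp
    qed
  qed
qed

text \<open>Induction on the total size of the pair. The letters at the first difference form a
  smaller pair unless both are the leaves of the respective root indices, and then totality of
  \<open>R\<close> decides.\<close>

lemma less_total: "x \<in> T \<Longrightarrow> y \<in> T \<Longrightarrow> x \<noteq> y \<Longrightarrow> less x y \<or> less y x"
proof (induction "length x + length y" arbitrary: x y rule: less_induct)
  case less
  note T = \<open>x \<in> T\<close> \<open>y \<in> T\<close>
  show ?case
  proof (cases "word x = word y")
    case True
    then have "root_label x \<noteq> root_label y" "root_index x = root_index y"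
      using T_eqI less word_eq_iff by blast+
    then show ?thesis
      using L_D(3)[OF T_D(3)[OF T(1)]] T_D(4)[OF T(1)] T_D(4)[OF T(2)] True T
        label[of x y] label[of y x]
      by (auto simp: total_on_def)
  next
    case False
    then obtain n where n: "\<forall>m<n. word x !! m = word y !! m" "word x !! n \<noteq> word y !! n"
      by (rule stream_first_difference)
    let ?a = "word x !! n" and ?b = "word y !! n"
    have ab: "?a \<in> T" "?b \<in> T" using T word_in_streams snth_in by blast+
    \<comment> \<open>A leaf is coded by a single entry, so no tree is shorter; this covers pairs in
      which only one letter is known to be strictly smaller.\<close>
    have le: "length (leaf j) \<le> length z" if "z \<in> T" for z j
      using T_D(1)[OF that] by (metis One_nat_def Suc_leI leaf_def length_greater_0_conv
        list.size(3) concat.simps(1) length_Cons list.distinct(1) node_def)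
    have "less ?a ?b \<or> less ?b ?a"
    proof (cases "?a = leaf (root_index x) \<and> ?b = leaf (root_index y)")
      case True
      then have "root_index x \<noteq> root_index y" using n(2) by auto
      then show ?thesis
        using True R_D(3) T_D(3)[OF T(1)] T_D(3)[OF T(2)] leaf
        by (metis total_on_def)
    next
      case False
      have "length ?a + length ?b < length x + length y"
        using False word_snth_cases[OF T(1), of n] word_snth_cases[OF T(2), of n] le[OF T(1)] le[OF T(2)]
        by (metis add_le_less_mono add_less_le_mono less_imp_le_nat)
      then show ?thesis using less.hyps ab n(2) by blast
    qed
    then show ?thesis using n(1) T step by metis
  qed
qed

lemma Field_X: "Field X = T"
  by (auto simp: X_def Field_def)

lemma Linear_order_X: "Linear_order X"
proof -
  have "refl_on T X" "X \<subseteq> T \<times> T" by (auto simp: refl_on_def X_def)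
  moreover have "trans X" unfolding X_def by (rule transI) (auto intro: less_trans)
  moreover have "antisym X" unfolding X_def by (rule antisymI) (auto dest: less_asym)
  moreover have "total_on T X" unfolding X_def by (rule total_onI) (auto dest: less_total)
  ultimately show ?thesis by (simp add: Field_X order_on_defs)
qed

section \<open>The family \<open>I\<close> and the isomorphism with the replacement\<close>

definition leaf_class :: "'j \<Rightarrow> (nat \<times> 'j \<times> 'a) list stream set"
  where "leaf_class j = tail_class T (sconst (leaf j))"

definition I :: "(nat \<times> 'j \<times> 'a) list stream set \<Rightarrow> 'a rel"
  where "I c = (if c \<in> leaf_class ` J then L (inv_into J leaf_class c) else {})"

text \<open>Every tail of a constant stream is the stream itself, so sharing a tail with it means
  being eventually constant.\<close>

lemma tail_class_eq_leaf_class_iff: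
  assumes "u \<in> streams T" "j \<in> J"
  shows "tail_class T u = leaf_class j \<longleftrightarrow> (\<exists>m. sdrop m u = sconst (leaf j))"
  using assms
  by (simp add: leaf_class_def tail_class_eq_iff sconst_streams leaf_in_T)

lemma inj_on_leaf_class: "inj_on leaf_class J"
proof (rule inj_onI)
  fix j k assume jk: "j \<in> J" "k \<in> J" "leaf_class j = leaf_class k"
  then have "sconst (leaf j) = sconst (leaf k)"
    using tail_class_eq_leaf_class_iff[of "sconst (leaf j)" k]
    by (simp add: leaf_class_def sconst_streams leaf_in_T)
  then show "j = k" by (metis leaf_inject siterate.simps(1))
qed

lemma leaf_class_in_tail_classes: "j \<in> J \<Longrightarrow> leaf_class j \<in> tail_classes T"
  by (simp add: leaf_class_def tail_class_in_tail_classes sconst_streams leaf_in_T)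

lemma I_leaf_class: "j \<in> J \<Longrightarrow> I (leaf_class j) = L j"
  using inj_on_leaf_class by (simp add: I_def)

lemma I_cases:
  obtains j where "j \<in> J" "c = leaf_class j" "I c = L j" | "I c = {}"
  using I_leaf_class by (cases "c \<in> leaf_class ` J") (auto simp: I_def)

lemma Linear_order_I: "Linear_order (I c)"
  by (rule I_cases[of c]) (auto simp: L_linear)

lemma tail_class_word: "x \<in> T \<Longrightarrow> tail_class T (word x) = leaf_class (root_index x)"
  using T_D(3)[of x] word_in_streams[of x]
  by (auto simp: tail_class_eq_leaf_class_iff word_def sdrop_shift
      intro!: exI[of _ "length (children x)"])

text \<open>Surjectivity of the map from trees to labelled streams: the children are the letters of
  \<open>u\<close> before it becomes constant.\<close>

lemma exists_tree_of_word:
  assumes u: "u \<in> streams T" and j: "j \<in> J" and i: "i \<in> Field (L j)"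
    and tail: "tail_class T u = leaf_class j"
  shows "\<exists>x \<in> T. word x = u \<and> root_label x = i"
proof -
  \<comment> \<open>The cut must be the least one: if the prefix ended in \<open>leaf j\<close>, the
    constant part would already begin one position earlier.\<close>
  define m where "m = (LEAST m. sdrop m u = sconst (leaf j))"
  have ex: "\<exists>m. sdrop m u = sconst (leaf j)"
    using tail tail_class_eq_leaf_class_iff u j by blast
  have m: "sdrop m u = sconst (leaf j)"
    unfolding m_def using LeastI_ex[OF ex] .
  have min: "sdrop k u \<noteq> sconst (leaf j)" if "k < m" for k
    using that not_less_Least unfolding m_def by blast
  let ?w = "stake m u"
  have "last ?w \<noteq> leaf j" if w: "?w \<noteq> []"
  proof
    assume last: "last ?w = leaf j"
    obtain k where k: "m = Suc k" using w by (cases m) simp_all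
    have "u !! k = leaf j" using last by (simp add: k stake_Suc del: stake.simps)
    then have "sdrop k u = leaf j ## sconst (leaf j)"
      using m k by (metis sdrop_simps(1) sdrop_simps(2) stream.collapse sdrop_stl sdrop.simps(2))
    also have "\<dots> = sconst (leaf j)" by (subst (2) siterate.code) simp
    finally show False using min[of k] k by simp
  qed
  moreover have "set ?w \<subseteq> T"
    using u by (auto simp: in_set_conv_nth stake_nth snth_in)
  ultimately have "node ?w j i \<in> T" using i j by (intro T.intros) auto
  moreover have "word (node ?w j i) = u"
    using stake_sdrop[of m u] by (simp add: word_def m)
  ultimately show ?thesis by (intro bexI[of _ "node ?w j i"]) auto
qed

text \<open>A tree goes to its stream and root label. Rule \<open>label\<close> handles equal
  streams and \<open>step\<close> their first difference, so \<open>less\<close> unfolds to the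
  lexicographic order of the replacement.\<close>

lemma X_iso_omega_replacement: "X \<cong>\<^sub>o omega_replacement X I"
proof -
  let ?Y = "omega_replacement X I" and ?f = "\<lambda>x. (word x, root_label x)"
  have FY: "Field ?Y = (SIGMA u:streams T. Field (I (tail_class T u)))"
    unfolding omega_replacement_def
    by (subst Field_replacement)
      (use Linear_order_omega_power[OF Linear_order_X] Linear_order_I in
        \<open>auto simp: Field_omega_power Field_X\<close>)
  have I_word: "I (tail_class T (word x)) = L (root_index x)" if "x \<in> T" for x
    using that by (simp add: tail_class_word I_leaf_class T_D(3))
  have "bij_betw ?f T (Field ?Y)"
  proof (rule bij_betwI')
    fix x y assume "x \<in> T" "y \<in> T"
    then show "?f x = ?f y \<longleftrightarrow> x = y" using T_eqI by auto
  next
    fix x assume "x \<in> T"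
    then show "?f x \<in> Field ?Y" by (simp add: FY word_in_streams I_word T_D(4))
  next
    fix p assume "p \<in> Field ?Y"
    then obtain u i where p: "p = (u, i)" "u \<in> streams T" "i \<in> Field (I (tail_class T u))"
      unfolding FY by blast
    obtain j where "j \<in> J" "tail_class T u = leaf_class j" "i \<in> Field (L j)"
      by (rule I_cases[of "tail_class T u"]) (use p(3) in auto)
    then obtain x where "x \<in> T" "word x = u" "root_label x = i"
      using exists_tree_of_word p(2) by blast
    then show "\<exists>x\<in>T. p = ?f x" using p(1) by blast
  qed
  moreover have "(x, y) \<in> X \<longleftrightarrow> (?f x, ?f y) \<in> ?Y" if T: "x \<in> T" "y \<in> T" for x y
  proof
    assume xy: "(x, y) \<in> X"
    have "word x \<noteq> word y \<and> (word x, word y) \<in> omega_power X \<or>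
      word x = word y \<and> (root_label x, root_label y) \<in> L (root_index x)"
    proof (cases "x = y")
      case True
      then show ?thesis
        using T T_D(4) L_D(4)[OF T_D(3)] by (metis refl_onD)
    next
      case False
      then have "less x y" using xy by (simp add: X_def)
      then show ?thesis
      proof (cases rule: less_cases)
        case (step n)
        \<comment> \<open>Irreflexivity turns the position given by \<open>step\<close> into a
          genuine first difference, as \<open>omega_power\<close> demands.\<close>
        then have "word x !! n \<noteq> word y !! n" "(word x !! n, word y !! n) \<in> X"
          using less_irrefl less_in_T by (metis, auto simp: X_def)
        then show ?thesis
          using step word_in_streams T by (auto simp: omega_power_def Field_X)
      qed simp
    qed
    then show "(?f x, ?f y) \<in> ?Y"
      using T by (simp add: omega_replacement_def replacement_def Field_omega_power Field_X
          word_in_streams I_word T_D(4))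
  next
    assume "(?f x, ?f y) \<in> ?Y"
    then consider "word x \<noteq> word y" "(word x, word y) \<in> omega_power X"
      | "word x = word y" "(root_label x, root_label y) \<in> L (root_index x)"
      using T by (auto simp: omega_replacement_def replacement_def Field_X I_word)
    then show "(x, y) \<in> X"
    proof cases
      case 1
      then obtain n where "\<forall>m<n. word x !! m = word y !! m" "less (word x !! n) (word y !! n)"
        by (auto simp: omega_power_def X_def)
      then show ?thesis using step T by (auto simp: X_def)
    next
      case 2
      then show ?thesis
        using T label T_eqI by (cases "root_label x = root_label y") (auto simp: X_def)
    qed
  qed
  ultimately show ?thesis
    unfolding order_iso_def iso_iff2 Field_X by blast
qed

text \<open>Distinct leaf classes come from distinct indices, and an order isomorphic to the empty
  one is itself empty.\<close>

lemma I_not_iso: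
  assumes "c \<noteq> d"
  shows "I c = {} \<and> I d = {} \<or> \<not> I c \<cong>\<^sub>o I d"
proof (rule I_cases[of c]; rule I_cases[of d])
  fix j k assume "j \<in> J" "c = leaf_class j" "I c = L j" "k \<in> J" "d = leaf_class k" "I d = L k"
  then show ?thesis using L_not_iso assms by metis
qed (use order_iso_emptyD order_iso_sym in metis)+

text \<open>A second class with value \<open>L j\<close> would contradict \<open>I_not_iso\<close>,
  since \<open>L j\<close> is nonempty and isomorphic to itself.\<close>

lemma ex1_I_eq:
  assumes "j \<in> J"
  shows "\<exists>!c. c \<in> tail_classes T \<and> I c = L j"
proof (rule ex1I[of _ "leaf_class j"])
  show "leaf_class j \<in> tail_classes T \<and> I (leaf_class j) = L j"
    using assms by (simp add: leaf_class_in_tail_classes I_leaf_class)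
  fix c assume "c \<in> tail_classes T \<and> I c = L j"
  then show "c = leaf_class j"
    using I_not_iso[of c "leaf_class j"] I_leaf_class[OF assms] L_nonempty[OF assms] order_iso_refl
    by metis
qed

end

theorem theorem5p2:
  fixes J :: "'j set" and L :: "'j \<Rightarrow> 'a rel"
  assumes "\<And>j. j \<in> J \<Longrightarrow> Linear_order (L j)"
    and "\<And>j. j \<in> J \<Longrightarrow> L j \<noteq> {}"
    and "\<And>i j. i \<in> J \<Longrightarrow> j \<in> J \<Longrightarrow> i \<noteq> j \<Longrightarrow> \<not> L i \<cong>\<^sub>o L j"
  shows "\<exists>(X :: (nat \<times> 'j \<times> 'a) list rel) (I :: (nat \<times> 'j \<times> 'a) list stream set \<Rightarrow> 'a rel).
    Linear_order X \<and>
    (\<forall>c \<in> tail_classes (Field X). Linear_order (I c)) \<and>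
    X \<cong>\<^sub>o omega_replacement X I \<and>
    order_square X \<cong>\<^sub>o X \<and>
    (\<forall>u \<in> streams (Field X). \<forall>v \<in> streams (Field X).
       tail_class (Field X) u \<noteq> tail_class (Field X) v \<longrightarrow>
         (I (tail_class (Field X) u) = {} \<and> I (tail_class (Field X) v) = {}) \<or>
         \<not> I (tail_class (Field X) u) \<cong>\<^sub>o I (tail_class (Field X) v)) \<and>
    (\<forall>j \<in> J. \<exists>!c. c \<in> tail_classes (Field X) \<and> I c = L j)"
proof -
  \<comment> \<open>The well-ordering theorem supplies the linear order on the indices that compares
    leaves.\<close>
  obtain R where "well_order_on J R" using well_order_on by blast
  then interpret order_family J L R
    using assms by unfold_locales (auto simp: well_order_on_def)
  show ?thesis
    using Linear_order_X Linear_order_I X_iso_omega_replacement I_not_iso ex1_I_eq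
      order_square_iso_of_omega_replacement_iso[OF Linear_order_X Linear_order_I
        X_iso_omega_replacement]
    by (intro exI[of _ X] exI[of _ I]) (simp add: Field_X)
qed

end
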